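(* Let $\rho_0>0$ and let $v\in C^2(0,\rho_0)$ and $E_1,l,m\in C^0[0,\rho_0)$ be real functions such that $v(\rho)>0$ and $v$ is bounded on $(0,\rho_0)$, $E_1(0)>0$, and $l(0)<m(0)$. Let $E_2=E_2(\rho,v)$ be a real function continuous in $(\rho,v)\in[0,\rho_0)\times[0,\infty)$ with $E_2(0,0)=0$. Suppose $v$ satisfies the ODE $$v(\rho)v''(\rho)=E_1(\rho)\,(v'(\rho)-l(\rho))(v'(\rho)-m(\rho))+E_2(\rho,v(\rho)),\qquad \rho\in(0,\rho_0).$$ Then: (a) The limits of $v(\rho)$ and of $v'(\rho)$ exist as $\rho\to0$. (b) In case $\lim_{\rho\to0}v(\rho)=0$, either $$\lim_{\rho\to0}v'(\rho)=l(0)\quad\text{or}\quad\lim_{\rho\to0}v'(\rho)=m(0).$$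
   Context: Here $'$ denotes the derivative with respect to $\rho$. *)

theory Defs
  imports "HOL-Analysis.Analysis"
begin

end

theory Submission
  imports Defs
begin

text \<open>
  Write \<open>p = v'\<close>. Where \<open>\<bar>p\<bar>\<close> is large the equation forces \<open>v'' > 0\<close>, so large values of \<open>\<bar>p\<bar>\<close> act as
  one-sided barriers; together with the bound on \<open>v\<close> this keeps \<open>p\<close> bounded near \<open>0\<close>. Hence \<open>v\<close> is
  Lipschitz and has a limit \<open>a \<ge> 0\<close>. If \<open>a > 0\<close>, then \<open>v''\<close> is bounded as well and \<open>p\<close> converges. If
  \<open>a = 0\<close>, then \<open>v \<le> P \<rho>\<close>, so in the time variable \<open>ln \<rho>\<close> the quantity \<open>p\<close> moves at a rate bounded away
  from zero unless it is near \<open>l 0\<close> or \<open>m 0\<close>; as \<open>\<rho>\<close> decreases to \<open>0\<close>, \<open>m 0\<close> attracts and \<open>l 0\<close> repels.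
\<close>

section \<open>One-sided barriers and the effect of a rate \<open>c / x\<close> near
  \<open>0\<close>\<close>

text \<open>As \<open>x\<close> increases, \<open>f\<close> can cross the level \<open>A\<close>
  only downwards. Starting at or below \<open>A\<close> at \<open>a\<close> and being at or above it
  at \<open>b\<close> would force a first return to \<open>A\<close> from below, where the
  derivative could not be negative.\<close>

lemma barrier_at_left:
  fixes f f' :: "real \<Rightarrow> real"
  assumes deriv: "\<And>x. x \<in> {0<..<r} \<Longrightarrow> (f has_real_derivative f' x) (at x)"
    and neg: "\<And>x. x \<in> {0<..<r} \<Longrightarrow> f x = A \<Longrightarrow> f' x < 0"
    and b: "b < r" "A \<le> f b"
    and a: "0 < a" "a < b"
  shows "A < f a"
proof (rule ccontr)
  assume "\<not> A < f a"
  \<comment> \<open>If \<open>f a = A\<close>, the negative derivative pushes \<open>f\<close>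
    strictly below \<open>A\<close> just to the right of \<open>a\<close>.\<close>
  have "\<exists>c. a \<le> c \<and> c < b \<and> f c < A"
  proof (cases "f a = A")
    case True
    have "(f has_real_derivative f' a) (at a)" "f' a < 0"
      using deriv neg True a b by auto
    from DERIV_neg_dec_right[OF this] obtain d where
      d: "d > 0" "\<And>h. h > 0 \<Longrightarrow> h < d \<Longrightarrow> f (a + h) < f a" by auto
    define h where "h = min (d/2) ((b - a)/2)"
    have "h > 0" "h < d" "a + h < b" using d(1) a by (auto simp: h_def min_def field_simps)
    with d(2)[of h] True show ?thesis by (intro exI[of _ "a + h"]) auto
  next
    case False
    with \<open>\<not> A < f a\<close> a show ?thesis by auto
  qed
  then obtain c where c: "a \<le> c" "c < b" "f c < A" by blast
  have cont: "continuous_on {c..b} f"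
    by (rule DERIV_continuous_on, rule has_field_derivative_at_within, rule deriv) (use a b c in auto)
  \<comment> \<open>The least element \<open>t\<close> of \<open>S\<close> is the first return to
    level \<open>A\<close>; by the intermediate value theorem \<open>f t = A\<close>. A negative
    derivative there puts points left of \<open>t\<close> into \<open>S\<close>.\<close>
  define S where "S = {c..b} \<inter> f -` {A..}"
  have "closed S"
    unfolding S_def by (intro continuous_closed_preimage cont closed_atLeastAtMost closed_atLeast)
  then have "compact ({c..b} \<inter> S)"
    by (intro compact_Int_closed compact_Icc)
  moreover have "{c..b} \<inter> S = S" by (auto simp: S_def)
  ultimately have "compact S" by simp
  moreover have "b \<in> S" using b c by (auto simp: S_def)
  ultimately obtain t where t: "t \<in> S" "\<And>x. x \<in> S \<Longrightarrow> t \<le> x"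
    using compact_attains_inf[of S] by blast
  have tc: "c < t" "t \<le> b" "A \<le> f t" using t(1) c by (auto simp: S_def less_le)
  have "\<exists>x\<ge>c. x \<le> t \<and> f x = A"
    using c tc by (intro IVT' continuous_on_subset[OF cont]) auto
  then obtain x where x: "c \<le> x" "x \<le> t" "f x = A" by blast
  with t(2)[of x] tc have "x = t" by (auto simp: S_def)
  with x have ft: "f t = A" by simp
  have "(f has_real_derivative f' t) (at t)" "f' t < 0"
    using deriv neg ft a b tc c by auto
  from DERIV_neg_dec_left[OF this] obtain d where
    d: "d > 0" "\<And>h. h > 0 \<Longrightarrow> h < d \<Longrightarrow> f t < f (t - h)" by auto
  define h where "h = min (d/2) ((t - c)/2)"
  have h: "h > 0" "h < d" "c < t - h" using d(1) tc by (auto simp: h_def min_def field_simps)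
  with d(2)[of h] ft tc have "t - h \<in> S" by (auto simp: S_def)
  with t(2) h show False by fastforce
qed

text \<open>The singular rate \<open>c / x\<close> is not integrable at \<open>0\<close>, so \<open>f\<close> crosses the whole band \<open>[A, B]\<close>.\<close>

lemma pushed_above_at_right_0:
  fixes f f' :: "real \<Rightarrow> real"
  assumes deriv: "\<And>x. x \<in> {0<..<r} \<Longrightarrow> (f has_real_derivative f' x) (at x)"
    and push: "\<And>x. x \<in> {0<..<r} \<Longrightarrow> A \<le> f x \<Longrightarrow> f x \<le> B \<Longrightarrow> f' x \<le> - c / x"
    and "c > 0" "A \<le> B"
    and b: "0 < b" "b < r" "A \<le> f b"
  shows "eventually (\<lambda>x. B \<le> f x) (at_right 0)"
proof -
  have neg: "f' x < 0" if "x \<in> {0<..<r}" "A \<le> f x" "f x \<le> B" for x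
  proof -
    have "- c / x < 0" using that \<open>c > 0\<close> by auto
    with push[OF that] show ?thesis by linarith
  qed
  have above: "A < f x" if "0 < x" "x < b" for x
    by (rule barrier_at_left[where f' = f' and r = r and b = b])
       (use deriv neg b that \<open>A \<le> B\<close> in auto)
  have "\<exists>x. 0 < x \<and> x < b \<and> B \<le> f x"
  proof (rule ccontr)
    assume "\<not> ?thesis"
    then have below: "f x < B" if "0 < x" "x < b" for x using that by force
    define y where "y = b / 2"
    \<comment> \<open>While \<open>f\<close> stays in the band, \<open>g\<close> is nonincreasing,
      so \<open>f\<close> grows at least like \<open>- c * ln x\<close> towards \<open>0\<close>.
      The point \<open>z\<close> is small enough that \<open>c * ln z \<le> g y - B\<close>, which
      forces \<open>f z\<close> up to \<open>B\<close>.\<close>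
    define g where "g x = f x + c * ln x" for x
    define z where "z = min y (exp ((g y - B) / c))"
    have y: "0 < y" "y < b" using b by (auto simp: y_def)
    have z: "0 < z" "z \<le> y" using y by (auto simp: z_def)
    have "g y \<le> g z"
    proof (rule DERIV_nonpos_imp_nonincreasing[OF z(2)])
      fix x assume x: "z \<le> x" "x \<le> y"
      have x': "0 < x" "x < b" "x \<in> {0<..<r}" using x y z b by auto
      have "(g has_real_derivative f' x + c / x) (at x)"
        unfolding g_def using x' by (auto intro!: derivative_eq_intros deriv)
      moreover have "f' x + c / x \<le> 0"
        using push[of x] above[of x] below[of x] x' by auto
      ultimately show "\<exists>d. (g has_real_derivative d) (at x) \<and> d \<le> 0" by blast
    qed
    moreover have "c * ln z \<le> g y - B"
    proof -
      have "ln z \<le> ln (exp ((g y - B) / c))" using z(1) by (subst ln_le_cancel_iff) (auto simp: z_def)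
      then show ?thesis using \<open>c > 0\<close> by (simp add: field_simps)
    qed
    ultimately have "B \<le> f z" by (simp add: g_def)
    with below[of z] y z show False by simp
  qed
  then obtain x where x: "0 < x" "x < b" "B \<le> f x" by blast
  \<comment> \<open>Once \<open>B\<close> is reached, the barrier at level \<open>B\<close> prevents
    a fall back below it nearer to \<open>0\<close>.\<close>
  have "B < f y" if "0 < y" "y < x" for y
    by (rule barrier_at_left[where f' = f' and r = r and b = x])
       (use deriv neg b x that \<open>A \<le> B\<close> in auto)
  then show ?thesis
    unfolding eventually_at_right_field using x(1) by (intro exI[of _ x]) (auto intro: less_imp_le)
qed

section \<open>Limits at \<open>0\<close> from a bounded derivative\<close>

lemma at_within_Ioo_at_right: "a < b \<Longrightarrow> at a within {a<..<b} = at_right a" for a b :: real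
  by (rule at_within_nhd[of _ "{..<b}"]) auto

text \<open>A bounded derivative makes \<open>f\<close> Lipschitz, so it extends continuously to
  \<open>0\<close>; letting one point tend to \<open>0\<close> in the Lipschitz estimate gives the
  linear rate. This serves \<open>v\<close> and, when \<open>v\<close> stays away from
  \<open>0\<close>, also \<open>v'\<close>.\<close>

lemma tendsto_at_right_if_bounded_deriv:
  fixes f f' :: "real \<Rightarrow> real"
  assumes "0 < r"
    and deriv: "\<And>x. x \<in> {0<..<r} \<Longrightarrow> (f has_real_derivative f' x) (at x)"
    and bound: "\<And>x. x \<in> {0<..<r} \<Longrightarrow> \<bar>f' x\<bar> \<le> P"
  obtains a where "(f \<longlongrightarrow> a) (at_right 0)"
    and "\<And>x. x \<in> {0<..<r} \<Longrightarrow> \<bar>f x - a\<bar> \<le> P * x"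
proof -
  have lip: "\<bar>f x - f y\<bar> \<le> P * \<bar>x - y\<bar>" if "x \<in> {0<..<r}" "y \<in> {0<..<r}" for x y
    using field_differentiable_bound[of "{0<..<r}" f f' P x y] that deriv bound
    by (auto simp: has_field_derivative_at_within)
  have "P \<ge> 0" using bound[of "r / 2"] \<open>0 < r\<close> by auto
  then have "P-lipschitz_on {0<..<r} f"
    by (intro lipschitz_onI) (auto simp: dist_real_def intro!: lip)
  then have "uniformly_continuous_on {0<..<r} f"
    by (rule lipschitz_on_uniformly_continuous)
  moreover have "0 \<in> closure {0<..<r}" using \<open>0 < r\<close> by simp
  ultimately obtain a where "(f \<longlongrightarrow> a) (at 0 within {0<..<r})"
    by (rule uniformly_continuous_on_extension_at_closure)
  then have a: "(f \<longlongrightarrow> a) (at_right 0)"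
    using at_within_Ioo_at_right[OF \<open>0 < r\<close>] by simp
  have "\<bar>f x - a\<bar> \<le> P * x" if x: "x \<in> {0<..<r}" for x
  proof (rule tendsto_le)
    show "((\<lambda>y. P * \<bar>x - y\<bar>) \<longlongrightarrow> P * x) (at_right 0)"
      using x by (auto intro!: tendsto_eq_intros)
    show "((\<lambda>y. \<bar>f x - f y\<bar>) \<longlongrightarrow> \<bar>f x - a\<bar>) (at_right 0)"
      by (intro tendsto_intros a)
    show "eventually (\<lambda>y. \<bar>f x - f y\<bar> \<le> P * \<bar>x - y\<bar>) (at_right 0)"
      unfolding eventually_at_right_field using x lip by (intro exI[of _ r]) auto
  qed simp
  with a show ?thesis by (rule that)
qed

section \<open>Boundedness of the first derivative near \<open>0\<close>\<close>

text \<open>Upper bound: either \<open>p\<close> drops to \<open>K\<close> somewhere and the barrier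
  keeps it below from there towards \<open>0\<close>, or \<open>p\<close> is increasing throughout.
  Lower bound: if \<open>p\<close> ever reaches \<open>- K\<close>, then \<open>v\<close> increases
  towards \<open>0\<close>, hence stays away from zero, and the quadratic bound on \<open>q\<close>
  together with the bound on \<open>v\<close> controls \<open>ln (- p)\<close>.\<close>

lemma derivative_bounded_at_right_0:
  fixes v p q :: "real \<Rightarrow> real"
  assumes "0 < r" "0 < K"
    and v: "\<And>x. x \<in> {0<..<r} \<Longrightarrow> (v has_real_derivative p x) (at x)"
    and p: "\<And>x. x \<in> {0<..<r} \<Longrightarrow> (p has_real_derivative q x) (at x)"
    and vpos: "\<And>x. x \<in> {0<..<r} \<Longrightarrow> 0 < v x"
    and vle: "\<And>x. x \<in> {0<..<r} \<Longrightarrow> v x \<le> B"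
    and qpos: "\<And>x. x \<in> {0<..<r} \<Longrightarrow> K \<le> \<bar>p x\<bar> \<Longrightarrow> 0 < q x"
    and qle: "\<And>x. x \<in> {0<..<r} \<Longrightarrow> K \<le> \<bar>p x\<bar> \<Longrightarrow> v x * q x \<le> C * (p x)\<^sup>2"
  shows "\<exists>P. eventually (\<lambda>x. \<bar>p x\<bar> \<le> P) (at_right 0)"
proof -
  \<comment> \<open>The barrier for \<open>- p\<close> at level \<open>- k\<close>, needed for both
    \<open>k = K\<close> and \<open>k = - K\<close>.\<close>
  have bar: "p a < k" if "0 < a" "a < b" "b < r" "p b \<le> k" "\<bar>k\<bar> = K" for a b k
    using barrier_at_left[of r "\<lambda>x. - p x" "\<lambda>x. - q x" "-k" b a] that p qpos
    by (auto intro: DERIV_minus)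
  have "\<exists>s P. 0 < s \<and> (\<forall>x. 0 < x \<and> x < s \<longrightarrow> p x \<le> P)"
  proof (cases "\<exists>b. 0 < b \<and> b < r \<and> p b \<le> K")
    case True
    then obtain b where "0 < b" "b < r" "p b \<le> K" by blast
    then show ?thesis using bar[of _ b K] \<open>0 < K\<close> by (intro exI[of _ b] exI[of _ K]) (auto intro: less_imp_le)
  next
    case False
    have "p x \<le> p (r / 2)" if "0 < x" "x < r / 2" for x
    proof (rule DERIV_nonneg_imp_nondecreasing[where f = p])
      fix y assume "x \<le> y" "y \<le> r / 2"
      then have "y \<in> {0<..<r}" using that by auto
      moreover from this have "K \<le> \<bar>p y\<bar>" using False by force
      ultimately show "\<exists>d. (p has_real_derivative d) (at y) \<and> 0 \<le> d"
        using p qpos by (intro exI[of _ "q y"]) (auto intro: less_imp_le)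
    qed (use that in simp)
    then show ?thesis using \<open>0 < r\<close> by (intro exI[of _ "r / 2"] exI[of _ "p (r / 2)"]) auto
  qed
  then obtain s1 P1 where P1: "0 < s1" "\<And>x. 0 < x \<Longrightarrow> x < s1 \<Longrightarrow> p x \<le> P1" by blast
  have "\<exists>s P. 0 < s \<and> (\<forall>x. 0 < x \<and> x < s \<longrightarrow> P \<le> p x)"
  proof (cases "\<exists>b. 0 < b \<and> b < r \<and> p b \<le> - K")
    case True
    then obtain b where b: "0 < b" "b < r" "p b \<le> - K" by blast
    have small: "p x \<le> - K" if "0 < x" "x \<le> b" for x
      using bar[of x b "- K"] b that \<open>0 < K\<close> by (cases "x = b") (auto intro: less_imp_le)
    \<comment> \<open>This removes the singularity of the equation: the factor \<open>v\<close> in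
      front of \<open>q\<close> is at least \<open>v b > 0\<close>.\<close>
    have big: "v b \<le> v x" if "0 < x" "x \<le> b" for x
    proof (rule DERIV_nonpos_imp_nonincreasing[OF that(2)])
      fix y assume "x \<le> y" "y \<le> b"
      then show "\<exists>d. (v has_real_derivative d) (at y) \<and> d \<le> 0"
        using v[of y] small[of y] that b \<open>0 < K\<close> by (intro exI[of _ "p y"]) auto
    qed
    have vb: "0 < v b" using vpos b by auto
    define D where "D = C / v b"
    \<comment> \<open>Since \<open>0 < v'' \<le> D v'\<^sup>2\<close> and \<open>v' < 0\<close>, this logarithmic energy is nondecreasing.\<close>
    define g where "g x = ln (- p x) - D * v x" for x
    have gle: "g x \<le> g b" if "0 < x" "x \<le> b" for x
    proof (rule DERIV_nonneg_imp_nondecreasing[OF that(2)])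
      fix y assume "x \<le> y" "y \<le> b"
      then have y: "0 < y" "y \<le> b" "y \<in> {0<..<r}" using that b by auto
      have py: "p y < 0" "K \<le> \<bar>p y\<bar>" using small[of y] y \<open>0 < K\<close> by auto
      have "v b * q y \<le> v y * q y"
        using big[of y] y qpos[of y] py by (intro mult_right_mono) auto
      also have "\<dots> \<le> C * (p y)\<^sup>2" using qle y py by blast
      finally have "q y \<le> D * (p y)\<^sup>2" using vb by (simp add: D_def field_simps)
      then have "0 \<le> q y / p y - D * p y"
        using py by (simp add: field_simps power2_eq_square)
      moreover have "(g has_real_derivative q y / p y - D * p y) (at y)"
        unfolding g_def using py y by (auto intro!: derivative_eq_intros p v)
      ultimately show "\<exists>d. (g has_real_derivative d) (at y) \<and> 0 \<le> d" by blast
    qed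
    \<comment> \<open>The sign of \<open>D\<close> is not fixed, so the term \<open>D * v x\<close>
      is estimated by \<open>\<bar>D\<bar> * B\<close>.\<close>
    have "- exp (g b + \<bar>D\<bar> * B) \<le> p x" if "0 < x" "x < b" for x
    proof -
      have "D * v x \<le> \<bar>D\<bar> * B"
        using vpos[of x] vle[of x] that b by (intro mult_mono) auto
      then have "ln (- p x) \<le> g b + \<bar>D\<bar> * B"
        using gle[of x] that by (simp add: g_def)
      moreover have "0 < - p x" using small[of x] that \<open>0 < K\<close> by auto
      ultimately have "- p x \<le> exp (g b + \<bar>D\<bar> * B)"
        by (metis exp_le_cancel_iff exp_ln)
      then show ?thesis by simp
    qed
    then show ?thesis using b by blast
  next
    case False
    then show ?thesis using \<open>0 < r\<close> by (intro exI[of _ r] exI[of _ "- K"]) (auto simp: not_le less_imp_le)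
  qed
  then obtain s2 P2 where P2: "0 < s2" "\<And>x. 0 < x \<Longrightarrow> x < s2 \<Longrightarrow> P2 \<le> p x" by blast
  have "\<bar>p x\<bar> \<le> max \<bar>P1\<bar> \<bar>P2\<bar>" if "0 < x" "x < min s1 s2" for x
    using P1(2)[of x] P2(2)[of x] that by auto
  then show ?thesis
    unfolding eventually_at_right_field using P1(1) P2(1)
    by (intro exI[of _ "max \<bar>P1\<bar> \<bar>P2\<bar>"] exI[of _ "min s1 s2"]) auto
qed

section \<open>The case where \<open>v\<close> tends to \<open>0\<close>\<close>

text \<open>Dividing the equation by \<open>v x \<le> P * x\<close> gives \<open>q\<close> a size of
  at least \<open>c / x\<close> away from the roots, with the sign of
  \<open>(p - L) * (p - M)\<close>. Towards \<open>0\<close> this drives \<open>p\<close> to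
  \<open>M\<close> from either side of \<open>M\<close>, as long as it is above \<open>L\<close>;
  below \<open>L\<close> it would drive \<open>p\<close> out of its bounds.\<close>

lemma derivative_tendsto_root_at_singular_point:
  fixes v p q E l m h :: "real \<Rightarrow> real"
  assumes r: "0 < r"
    and p: "\<And>x. x \<in> {0<..<r} \<Longrightarrow> (p has_real_derivative q x) (at x)"
    and vpos: "\<And>x. x \<in> {0<..<r} \<Longrightarrow> 0 < v x"
    and vle: "\<And>x. x \<in> {0<..<r} \<Longrightarrow> v x \<le> P * x"
    and ple: "\<And>x. x \<in> {0<..<r} \<Longrightarrow> \<bar>p x\<bar> \<le> P"
    and ode: "\<And>x. x \<in> {0<..<r} \<Longrightarrow> v x * q x = E x * (p x - l x) * (p x - m x) + h x"
    and lim: "(E \<longlongrightarrow> e) (at_right 0)" "(l \<longlongrightarrow> L) (at_right 0)" "(m \<longlongrightarrow> M) (at_right 0)"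
      "(h \<longlongrightarrow> 0) (at_right 0)"
    and "0 < e" "L < M"
  shows "(p \<longlongrightarrow> L) (at_right 0) \<or> (p \<longlongrightarrow> M) (at_right 0)"
proof -
  have "0 < P * (r / 2)" using vpos[of "r / 2"] vle[of "r / 2"] r by auto
  then have "0 < P" using r by (simp add: zero_less_mult_iff)
  have rates: "\<exists>s c. 0 < s \<and> s \<le> r \<and> 0 < c \<and> (\<forall>x\<in>{0<..<s}.
      (p x \<le> L - d \<or> M + d \<le> p x \<longrightarrow> c / x \<le> q x) \<and>
      (L + d \<le> p x \<and> p x \<le> M - d \<longrightarrow> q x \<le> - c / x))" if d: "0 < d" for d
  proof -
    \<comment> \<open>The lower bounds \<open>e / 2\<close>, \<open>d / 2\<close>,
      \<open>d / 2\<close> on the three factors multiply to \<open>2 * k\<close>; the perturbation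
      \<open>h\<close> takes at most one \<open>k\<close>.\<close>
    define k where "k = e * d\<^sup>2 / 16"
    have k: "0 < k" using d \<open>0 < e\<close> by (simp add: k_def)
    have "eventually (\<lambda>x. e / 2 < E x \<and> \<bar>l x - L\<bar> < d / 2 \<and> \<bar>m x - M\<bar> < d / 2 \<and> \<bar>h x\<bar> < k) (at_right 0)"
      unfolding dist_real_def[symmetric]
      by (intro eventually_conj order_tendstoD[OF lim(1)] tendstoD[OF lim(2)] tendstoD[OF lim(3)]
            tendstoD[OF lim(4), unfolded dist_real_def diff_0_right])
        (use d k \<open>0 < e\<close> in simp_all)
    then obtain s0 where s0: "0 < s0" "\<And>x. 0 < x \<Longrightarrow> x < s0 \<Longrightarrow>
        e / 2 < E x \<and> \<bar>l x - L\<bar> < d / 2 \<and> \<bar>m x - M\<bar> < d / 2 \<and> \<bar>h x\<bar> < k"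
      unfolding eventually_at_right_field by auto
    have prod: "2 * k \<le> E x * (a * b)" if "0 < x" "x < s0" "d / 2 \<le> a" "d / 2 \<le> b" for x a b
    proof -
      have "(e / 2) * ((d / 2) * (d / 2)) \<le> E x * (a * b)"
        using that s0(2)[of x] d \<open>0 < e\<close> by (intro mult_mono) auto
      then show ?thesis by (simp add: k_def power2_eq_square mult_ac)
    qed
    have divide: "(k / P) / x \<le> t" if "x \<in> {0<..<r}" "k \<le> v x * t" for x t
    proof -
      have "0 < t" using that k vpos[of x] by (metis less_le_trans zero_less_mult_pos)
      then have "v x * t \<le> (P * x) * t" using vle that by (intro mult_right_mono) auto
      with that have "k \<le> P * x * t" by linarith
      then show ?thesis using that \<open>0 < P\<close> by (simp add: field_simps)
    qed
    show ?thesis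
    proof (rule exI[of _ "min s0 r"], rule exI[of _ "k / P"], intro conjI ballI impI)
      fix x assume x: "x \<in> {0<..<min s0 r}"
      then have x': "0 < x" "x < s0" "x \<in> {0<..<r}" by auto
      note close = s0(2)[OF x'(1,2), unfolded abs_diff_less_iff]
      {
        assume "p x \<le> L - d \<or> M + d \<le> p x"
        then have "2 * k \<le> E x * ((p x - l x) * (p x - m x))"
        proof
          assume "p x \<le> L - d"
          then have "2 * k \<le> E x * ((l x - p x) * (m x - p x))"
            using close \<open>L < M\<close> by (intro prod x'(1,2)) linarith+
          then show ?thesis by (simp add: algebra_simps)
        next
          assume "M + d \<le> p x"
          then show ?thesis using close \<open>L < M\<close> by (intro prod x'(1,2)) linarith+
        qed
        then have "k \<le> v x * q x" using ode[OF x'(3)] close unfolding mult.assoc by linarith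
        then show "(k / P) / x \<le> q x" by (rule divide[OF x'(3)])
      }
      {
        assume "L + d \<le> p x \<and> p x \<le> M - d"
        then have "2 * k \<le> E x * ((p x - l x) * (m x - p x))"
          using close by (intro prod x'(1,2)) linarith+
        then have "2 * k \<le> - (E x * (p x - l x) * (p x - m x))"
          by (simp add: algebra_simps)
        then have "k \<le> v x * (- q x)" using ode[OF x'(3)] close unfolding mult_minus_right by linarith
        then have "(k / P) / x \<le> - q x" by (rule divide[OF x'(3)])
        then show "q x \<le> - (k / P) / x" by simp
      }
    qed (use s0 r k \<open>0 < P\<close> in auto)
  qed
  have np: "((\<lambda>x. - p x) has_real_derivative - q x) (at x)" if "x \<in> {0<..<r}" for x
    using p[OF that] by (rule DERIV_minus)
  have upper: "eventually (\<lambda>x. p x \<le> M + d) (at_right 0)" if "0 < d" for d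
  proof -
    from rates[OF that] obtain s c where s: "0 < s" "s \<le> r" "0 < c"
      and q: "\<And>x. x \<in> {0<..<s} \<Longrightarrow> M + d \<le> p x \<Longrightarrow> c / x \<le> q x" by blast
    \<comment> \<open>The minimum with \<open>- P\<close> makes the starting condition automatic,
      since \<open>\<bar>p\<bar> \<le> P\<close>, and the band then contains every possible value of
      \<open>p\<close> above \<open>M + d\<close>.\<close>
    have "eventually (\<lambda>x. - (M + d) \<le> - p x) (at_right 0)"
    proof (rule pushed_above_at_right_0[where r = s and f' = "\<lambda>x. - q x" and c = c
          and A = "min (- P) (- (M + d))" and b = "s / 2"])
      show "min (- P) (- (M + d)) \<le> - p (s / 2)" using ple[of "s / 2"] s by auto
    qed (use s np q in auto)
    then show ?thesis by eventually_elim simp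
  qed
  have lower: "eventually (\<lambda>x. L - d \<le> p x) (at_right 0)" if "0 < d" for d
  proof -
    from rates[OF that] obtain s c where s: "0 < s" "s \<le> r" "0 < c"
      and q: "\<And>x. x \<in> {0<..<s} \<Longrightarrow> p x \<le> L - d \<Longrightarrow> c / x \<le> q x" by blast
    \<comment> \<open>A single value below \<open>L - d\<close> would drive \<open>- p\<close> up to
      \<open>P + 1\<close>, contradicting the bound \<open>P\<close>.\<close>
    have "L - d \<le> p b" if b: "0 < b" "b < s" for b
    proof (rule ccontr)
      assume "\<not> L - d \<le> p b"
      then have "eventually (\<lambda>x. max (d - L) (P + 1) \<le> - p x) (at_right 0)"
        by (intro pushed_above_at_right_0[where r = s and f' = "\<lambda>x. - q x" and c = c
          and A = "d - L" and b = b]) (use s np q b in auto)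
      moreover have "eventually (\<lambda>x. - p x \<le> P) (at_right 0)"
        unfolding eventually_at_right_field using r ple by (intro exI[of _ r]) (auto simp: abs_le_iff)
      ultimately have "eventually (\<lambda>x::real. False) (at_right 0)"
        by eventually_elim auto
      then show False by simp
    qed
    then show ?thesis
      unfolding eventually_at_right_field using s by (intro exI[of _ s]) auto
  qed
  show ?thesis
  \<comment> \<open>Either \<open>p\<close> exceeds \<open>L\<close> by a fixed amount arbitrarily
    close to \<open>0\<close>, and one such point suffices to be carried up to \<open>M\<close>, or
    the upper limit of \<open>p\<close> is at most \<open>L\<close>.\<close>
  proof (cases "\<exists>d>0. \<exists>\<^sub>F x in at_right 0. L + d \<le> p x")
    case True
    then obtain d0 where d0: "0 < d0" "\<exists>\<^sub>F x in at_right 0. L + d0 \<le> p x" by blast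
    have "eventually (\<lambda>x. M - d \<le> p x) (at_right 0)" if "0 < d" for d
    proof -
      \<comment> \<open>Small enough for the band from \<open>L + d'\<close> to
        \<open>M - d'\<close> to be nonempty and for the starting value \<open>L + d0\<close> to lie
        at or above its lower end.\<close>
      define d' where "d' = min d (min d0 ((M - L) / 2))"
      have d': "0 < d'" "d' \<le> d" "d' \<le> d0" "L + d' \<le> M - d'"
        using that d0 \<open>L < M\<close> by (auto simp: d'_def min_def field_simps)
      from rates[OF d'(1)] obtain s c where s: "0 < s" "s \<le> r" "0 < c"
        and q: "\<And>x. x \<in> {0<..<s} \<Longrightarrow> L + d' \<le> p x \<Longrightarrow> p x \<le> M - d' \<Longrightarrow> q x \<le> - c / x" by blast
      have "eventually (\<lambda>x. 0 < x \<and> x < s) (at_right 0)"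
        unfolding eventually_at_right_field using s by (intro exI[of _ s]) auto
      then have "\<exists>\<^sub>F x in at_right 0. L + d0 \<le> p x \<and> 0 < x \<and> x < s"
        by (rule frequently_eventually_frequently[OF d0(2)])
      then obtain b where b: "L + d0 \<le> p b" "0 < b" "b < s"
        using frequently_ex by blast
      have "eventually (\<lambda>x. M - d' \<le> p x) (at_right 0)"
        by (rule pushed_above_at_right_0[where r = s and f' = q and c = c and A = "L + d'" and b = b])
           (use s p q b d' in auto)
      then show ?thesis by eventually_elim (use d' in auto)
    qed
    then have "(p \<longlongrightarrow> M) (at_right 0)"
    proof (intro tendstoI)
      fix \<epsilon> :: real assume eps: "0 < \<epsilon>" and low: "\<And>d. 0 < d \<Longrightarrow> eventually (\<lambda>x. M - d \<le> p x) (at_right 0)"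
      show "eventually (\<lambda>x. dist (p x) M < \<epsilon>) (at_right 0)"
        using low[OF half_gt_zero[OF eps]] upper[OF half_gt_zero[OF eps]]
        by eventually_elim (use eps in \<open>simp add: dist_real_def abs_less_iff\<close>)
    qed
    then show ?thesis ..
  next
    case False
    have "(p \<longlongrightarrow> L) (at_right 0)"
    proof (rule tendstoI)
      fix \<epsilon> :: real assume eps: "0 < \<epsilon>"
      have "eventually (\<lambda>x. p x < L + \<epsilon>) (at_right 0)"
        using False eps by (auto simp: not_frequently not_le)
      with lower[OF half_gt_zero[OF eps]] show "eventually (\<lambda>x. dist (p x) L < \<epsilon>) (at_right 0)"
        by eventually_elim (use eps in \<open>simp add: dist_real_def abs_less_iff\<close>)
    qed
    then show ?thesis ..
  qed
qed

section \<open>Uniform bounds on the coefficients, then the two cases for the limit of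
  \<open>v\<close>\<close>

theorem theoremA1:
  fixes \<rho>0 :: real
    and v v' v'' E1 l m :: "real \<Rightarrow> real"
    and E2 :: "real \<Rightarrow> real \<Rightarrow> real"
  assumes "\<rho>0 > 0"
    and "\<And>\<rho>. \<rho> \<in> {0<..<\<rho>0} \<Longrightarrow> (v has_real_derivative v' \<rho>) (at \<rho>)"
    and "\<And>\<rho>. \<rho> \<in> {0<..<\<rho>0} \<Longrightarrow> (v' has_real_derivative v'' \<rho>) (at \<rho>)"
    and "continuous_on {0<..<\<rho>0} v''"
    and "continuous_on {0..<\<rho>0} E1"
    and "continuous_on {0..<\<rho>0} l"
    and "continuous_on {0..<\<rho>0} m"
    and "\<And>\<rho>. \<rho> \<in> {0<..<\<rho>0} \<Longrightarrow> v \<rho> > 0"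
    and "bounded (v ` {0<..<\<rho>0})"
    and "E1 0 > 0"
    and "l 0 < m 0"
    and "continuous_on ({0..<\<rho>0} \<times> {0..}) (\<lambda>(\<rho>, y). E2 \<rho> y)"
    and "E2 0 0 = 0"
    and "\<And>\<rho>. \<rho> \<in> {0<..<\<rho>0} \<Longrightarrow>
           v \<rho> * v'' \<rho> = E1 \<rho> * (v' \<rho> - l \<rho>) * (v' \<rho> - m \<rho>) + E2 \<rho> (v \<rho>)"
  shows "((\<exists>a::real. (v \<longlongrightarrow> a) (at_right 0)) \<and> (\<exists>b::real. (v' \<longlongrightarrow> b) (at_right 0))) \<and>
         ((v \<longlongrightarrow> 0) (at_right 0) \<longrightarrow>
            (v' \<longlongrightarrow> l 0) (at_right 0) \<or> (v' \<longlongrightarrow> m 0) (at_right 0))"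
proof -
  let ?L = "l 0" and ?M = "m 0"
  note v = assms(2) and p = assms(3) and vpos = assms(8) and ode = assms(14)
  have lim0: "(f \<longlongrightarrow> f 0) (at_right 0)" if "continuous_on {0..<\<rho>0} f" for f :: "real \<Rightarrow> real"
  proof -
    have "(f \<longlongrightarrow> f 0) (at 0 within {0..<\<rho>0})"
      using that assms(1) by (auto simp: continuous_on_def)
    then have "(f \<longlongrightarrow> f 0) (at 0 within {0<..<\<rho>0})"
      by (rule tendsto_within_subset) auto
    then show ?thesis using at_within_Ioo_at_right[OF assms(1)] by simp
  qed
  note lims = lim0[OF assms(5)] lim0[OF assms(6)] lim0[OF assms(7)]
  obtain B where B: "\<And>x. x \<in> {0<..<\<rho>0} \<Longrightarrow> v x \<le> B" "0 < B"
    
  proof -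
    obtain b where "0 < b" "\<forall>y\<in>v ` {0<..<\<rho>0}. norm y \<le> b"
      using assms(9) unfolding bounded_pos by blast
    then show ?thesis by (intro that[of b]) (auto simp: abs_le_iff)
  qed
  define h where "h x = E2 x (v x)" for x
  \<comment> \<open>A compact rectangle on which \<open>E2\<close> is bounded; halving
    \<open>\<rho>0\<close> keeps it inside the half-open domain of continuity.\<close>
  define R where "R = {0..\<rho>0/2} \<times> {0..B}"
  have "compact ((\<lambda>(\<rho>, y). E2 \<rho> y) ` R)"
    unfolding R_def using assms(1)
    by (intro compact_continuous_image continuous_on_subset[OF assms(12)] compact_Times) auto
  then have "bounded ((\<lambda>(\<rho>, y). E2 \<rho> y) ` R)"
    by (rule compact_imp_bounded)
  then obtain H where "\<forall>z\<in>R. norm (case z of (\<rho>, y) \<Rightarrow> E2 \<rho> y) \<le> H"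
    unfolding bounded_iff ball_simps by (rule exE)
  then have H: "\<bar>E2 x y\<bar> \<le> H" if "x \<in> {0..\<rho>0/2}" "y \<in> {0..B}" for x y
    using that by (auto simp: R_def)
  \<comment> \<open>As \<open>E1 0 = 2 * e\<close>, \<open>E1\<close> lies between \<open>e\<close>
    and \<open>4 * e\<close> near \<open>0\<close>; \<open>N\<close> bounds \<open>l\<close> and
    \<open>m\<close> once they are within \<open>1\<close> of their limits.\<close>
  define e where "e = E1 0 / 2"
  define N where "N = \<bar>?L\<bar> + \<bar>?M\<bar> + 1"
  have "0 < e" using assms(10) by (simp add: e_def)
  have "1 \<le> N" by (simp add: N_def)
  have "0 \<le> H" using H[of 0 0] assms(1) \<open>0 < B\<close> by auto
  have "eventually (\<lambda>x. e < E1 x \<and> E1 x < 4 * e \<and> \<bar>l x - ?L\<bar> < 1 \<and> \<bar>m x - ?M\<bar> < 1) (at_right 0)"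
    unfolding dist_real_def[symmetric]
    by (intro eventually_conj order_tendstoD[OF lims(1)] tendstoD[OF lims(2)] tendstoD[OF lims(3)])
      (use \<open>0 < e\<close> in \<open>simp_all add: e_def\<close>)
  then obtain r0 where r0: "0 < r0" "\<And>x. 0 < x \<Longrightarrow> x < r0 \<Longrightarrow>
      e < E1 x \<and> E1 x < 4 * e \<and> \<bar>l x - ?L\<bar> < 1 \<and> \<bar>m x - ?M\<bar> < 1"
    unfolding eventually_at_right_field by blast
  define r where "r = min r0 (\<rho>0 / 2)"
  have r: "0 < r" using r0 assms(1) by (simp add: r_def)
  have in_r: "x \<in> {0<..<\<rho>0}" if "x \<in> {0<..<r}" for x using that by (auto simp: r_def)
  have bnd: "e \<le> E1 x" "E1 x \<le> 4 * e" "\<bar>l x\<bar> \<le> N" "\<bar>m x\<bar> \<le> N" "\<bar>h x\<bar> \<le> H" if "x \<in> {0<..<r}" for x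
  proof -
    have x: "0 < x" "x < r0" "x \<in> {0..\<rho>0/2}" using that by (auto simp: r_def)
    note close = r0(2)[OF x(1,2), unfolded abs_diff_less_iff]
    show "e \<le> E1 x" "E1 x \<le> 4 * e" using close by simp_all
    show "\<bar>l x\<bar> \<le> N" "\<bar>m x\<bar> \<le> N" unfolding N_def using close by linarith+
    have "v x \<in> {0..B}" using vpos[OF in_r[OF that]] B(1)[OF in_r[OF that]] by simp
    then show "\<bar>h x\<bar> \<le> H" unfolding h_def by (rule H[OF x(3)])
  qed
  have ode': "v x * v'' x = E1 x * (v' x - l x) * (v' x - m x) + h x" if "x \<in> {0<..<r}" for x
    using ode[OF in_r[OF that]] by (simp add: h_def)
  \<comment> \<open>This estimate yields both the quadratic growth bound for large \<open>v'\<close>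
    and, if \<open>v\<close> stays away from \<open>0\<close>, the bound on
    \<open>v''\<close>.\<close>
  have upper: "\<bar>v x * v'' x\<bar> \<le> 4 * e * (\<bar>v' x\<bar> + N)\<^sup>2 + H" if "x \<in> {0<..<r}" for x
  proof -
    have "\<bar>v x * v'' x\<bar> \<le> \<bar>E1 x * (v' x - l x) * (v' x - m x)\<bar> + \<bar>h x\<bar>"
      unfolding ode'[OF that] by (rule abs_triangle_ineq)
    also have "\<bar>E1 x * (v' x - l x) * (v' x - m x)\<bar> = \<bar>E1 x\<bar> * \<bar>v' x - l x\<bar> * \<bar>v' x - m x\<bar>"
      by (simp only: abs_mult)
    also have "\<dots> \<le> (4 * e) * (\<bar>v' x\<bar> + N) * (\<bar>v' x\<bar> + N)"
    proof (intro mult_mono mult_nonneg_nonneg add_nonneg_nonneg abs_ge_zero)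
      show "\<bar>E1 x\<bar> \<le> 4 * e" using bnd(1,2)[OF that] \<open>0 < e\<close> by simp
      show "\<bar>v' x - l x\<bar> \<le> \<bar>v' x\<bar> + N" "\<bar>v' x - m x\<bar> \<le> \<bar>v' x\<bar> + N"
        by (intro order_trans[OF abs_triangle_ineq4] add_left_mono bnd(3,4)[OF that])+
    qed (use \<open>0 < e\<close> \<open>1 \<le> N\<close> in simp_all)
    also have "\<dots> = 4 * e * (\<bar>v' x\<bar> + N)\<^sup>2"
      by (simp add: power2_eq_square)
    also have "4 * e * (\<bar>v' x\<bar> + N)\<^sup>2 + \<bar>h x\<bar> \<le> 4 * e * (\<bar>v' x\<bar> + N)\<^sup>2 + H"
      using bnd(5)[OF that] by (rule add_left_mono)
    finally show ?thesis by simp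
  qed
  \<comment> \<open>For \<open>\<bar>v'\<bar> \<ge> K\<close> both factors have the same sign and
    size at least \<open>1 + H / e\<close>, so the main term is at least \<open>e + H\<close> and
    outweighs \<open>h\<close>.\<close>
  define K where "K = N + 1 + H / e"
  have He: "0 \<le> H / e" using \<open>0 \<le> H\<close> \<open>0 < e\<close> by simp
  then have K: "0 < K" "1 \<le> K" "N \<le> K" unfolding K_def using \<open>1 \<le> N\<close> by linarith+
  have "\<exists>P. eventually (\<lambda>x. \<bar>v' x\<bar> \<le> P) (at_right 0)"
  proof (rule derivative_bounded_at_right_0[where v = v and q = v'' and r = r and K = K and B = B
        and C = "16 * e + H"])
    fix x assume x: "x \<in> {0<..<r}" and big: "K \<le> \<bar>v' x\<bar>"
    note bx = bnd[OF x]
    have K1: "1 + H / e \<le> K - N" by (simp add: K_def)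
    have prod: "1 + H / e \<le> a * b" if "K - N \<le> a" "K - N \<le> b" for a b
    proof -
      have "(1 + H / e) * 1 \<le> a * b"
        using that K1 He by (intro mult_mono) auto
      then show ?thesis by simp
    qed
    have "1 + H / e \<le> (v' x - l x) * (v' x - m x)"
    proof (cases "0 \<le> v' x")
      case True
      then show ?thesis using big bx(3,4) by (intro prod) linarith+
    next
      case False
      then have "1 + H / e \<le> (l x - v' x) * (m x - v' x)" using big bx(3,4) by (intro prod) linarith+
      then show ?thesis by (simp add: algebra_simps)
    qed
    then have "e * (1 + H / e) \<le> E1 x * ((v' x - l x) * (v' x - m x))"
      using bx(1) \<open>0 < e\<close> He by (intro mult_mono) auto
    then have "e + H \<le> E1 x * (v' x - l x) * (v' x - m x)"
      using \<open>0 < e\<close> by (simp add: distrib_left mult.assoc)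
    then have "0 < v x * v'' x" using ode'[OF x] bx(5) \<open>0 < e\<close> by linarith
    then show "0 < v'' x" using vpos[OF in_r[OF x]] by (simp add: zero_less_mult_iff)
    \<comment> \<open>Here \<open>N \<le> K \<le> \<bar>v' x\<bar>\<close> turns
      \<open>4 * e\<close> into \<open>16 * e\<close>, and \<open>1 \<le> K\<close> absorbs the
      constant \<open>H\<close> into \<open>H * (v' x)\<^sup>2\<close>.\<close>
    have "(\<bar>v' x\<bar> + N)\<^sup>2 \<le> (2 * \<bar>v' x\<bar>)\<^sup>2"
      using big K \<open>1 \<le> N\<close> by (intro power_mono) auto
    then have "4 * e * (\<bar>v' x\<bar> + N)\<^sup>2 \<le> 4 * e * (2 * \<bar>v' x\<bar>)\<^sup>2"
      using \<open>0 < e\<close> by (intro mult_left_mono) auto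
    moreover have "H * 1 \<le> H * (v' x)\<^sup>2"
    proof (rule mult_left_mono)
      have "1 \<le> \<bar>v' x\<bar>\<^sup>2" using big K by (intro one_le_power) auto
      then show "1 \<le> (v' x)\<^sup>2" by simp
    qed (rule \<open>0 \<le> H\<close>)
    ultimately show "v x * v'' x \<le> (16 * e + H) * (v' x)\<^sup>2"
      using upper[OF x] unfolding power_mult_distrib power2_abs distrib_right by simp
  qed (use r K(1) v[OF in_r] p[OF in_r] vpos[OF in_r] B(1)[OF in_r] in simp_all)
  then obtain P s0 where s0: "0 < s0" "\<And>x. 0 < x \<Longrightarrow> x < s0 \<Longrightarrow> \<bar>v' x\<bar> \<le> P"
    unfolding eventually_at_right_field by auto
  define s where "s = min s0 r"
  have s: "0 < s" using s0 r by (simp add: s_def)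
  have in_s: "x \<in> {0<..<r}" "x \<in> {0<..<\<rho>0}" "\<bar>v' x\<bar> \<le> P" if "x \<in> {0<..<s}" for x
  proof -
    have "0 < x" "x < s0" and x: "x \<in> {0<..<r}" using that by (auto simp: s_def)
    then show "\<bar>v' x\<bar> \<le> P" by (intro s0(2))
    show "x \<in> {0<..<r}" "x \<in> {0<..<\<rho>0}" using x in_r[OF x] by blast+
  qed
  obtain a where a: "(v \<longlongrightarrow> a) (at_right 0)" "\<And>x. x \<in> {0<..<s} \<Longrightarrow> \<bar>v x - a\<bar> \<le> P * x"
    by (rule tendsto_at_right_if_bounded_deriv[OF s, of v v' P]) (use v in_s in auto)
  have near: "eventually (\<lambda>x. x \<in> {0<..<s}) (at_right 0)"
    unfolding eventually_at_right_field using s by (intro exI[of _ s]) auto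
  have "0 \<le> a"
    by (rule tendsto_lowerbound[OF a(1)])
      (auto intro!: eventually_mono[OF near] less_imp_le vpos in_s)
  show ?thesis
  proof (cases "a = 0")
    case True
    \<comment> \<open>Joint continuity of \<open>E2\<close> at \<open>(0, 0)\<close> makes
      \<open>h\<close> vanish in the limit, and the linear rate in \<open>a(2)\<close> becomes
      \<open>v x \<le> P * x\<close>.\<close>
    have "((\<lambda>x. (x, v x)) \<longlongrightarrow> (0, 0)) (at_right 0)"
      using a(1) True by (auto intro!: tendsto_intros)
    moreover have "eventually (\<lambda>x. (x, v x) \<in> {0..<\<rho>0} \<times> {0..}) (at_right 0)"
      using near
    proof eventually_elim
      case (elim x)
      then show ?case using in_s(2)[OF elim] vpos[OF in_s(2)[OF elim]] by simp
    qed
    ultimately have "((\<lambda>x. (\<lambda>(\<rho>, y). E2 \<rho> y) (x, v x)) \<longlongrightarrow> (\<lambda>(\<rho>, y). E2 \<rho> y) (0, 0)) (at_right 0)"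
      using assms(1) by (intro continuous_on_tendsto_compose[OF assms(12)]) auto
    then have hlim: "(h \<longlongrightarrow> 0) (at_right 0)"
      using assms(13) by (simp add: h_def[abs_def])
    have "v x \<le> P * x" if "x \<in> {0<..<s}" for x
      using a(2)[OF that] unfolding True by linarith
    then have "(v' \<longlongrightarrow> ?L) (at_right 0) \<or> (v' \<longlongrightarrow> ?M) (at_right 0)"
      using in_s(3) by (intro derivative_tendsto_root_at_singular_point[where p = v' and L = ?L and M = ?M
            and r = s and v = v and q = v'' and P = P and E = E1 and l = l and m = m and h = h
            and e = "E1 0", OF s p[OF in_s(2)] vpos[OF in_s(2)] _ _ ode'[OF in_s(1)] lims hlim assms(10,11)])
    then show ?thesis using a(1) by blast
  next
    case False
    with \<open>0 \<le> a\<close> have "0 < a" by simp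
    \<comment> \<open>With \<open>v\<close> above \<open>a / 2\<close> the equation is regular:
      \<open>v''\<close> is bounded and \<open>v'\<close> converges. The claim for limit
      \<open>0\<close> is then vacuous by uniqueness of limits.\<close>
    have "eventually (\<lambda>x. a / 2 < v x \<and> x \<in> {0<..<s}) (at_right 0)"
      using order_tendstoD(1)[OF a(1), of "a / 2"] near \<open>0 < a\<close> by (auto intro: eventually_conj)
    then obtain t where t: "0 < t" "\<And>x. 0 < x \<Longrightarrow> x < t \<Longrightarrow> a / 2 < v x \<and> x \<in> {0<..<s}"
      unfolding eventually_at_right_field by auto
    have v''_le: "\<bar>v'' x\<bar> \<le> (4 * e * (P + N)\<^sup>2 + H) / (a / 2)" if "x \<in> {0<..<t}" for x
    proof -
      have x: "a / 2 < v x" "x \<in> {0<..<s}" using t(2)[of x] that by auto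
      have "(\<bar>v' x\<bar> + N)\<^sup>2 \<le> (P + N)\<^sup>2"
        using in_s(3)[OF x(2)] \<open>1 \<le> N\<close> by (intro power_mono) auto
      then have "4 * e * (\<bar>v' x\<bar> + N)\<^sup>2 \<le> 4 * e * (P + N)\<^sup>2"
        using \<open>0 < e\<close> by (intro mult_left_mono) auto
      moreover have "a / 2 * \<bar>v'' x\<bar> \<le> \<bar>v x * v'' x\<bar>"
        unfolding abs_mult using x \<open>0 < a\<close> by (intro mult_right_mono) auto
      ultimately have "a / 2 * \<bar>v'' x\<bar> \<le> 4 * e * (P + N)\<^sup>2 + H"
        using upper[OF in_s(1)[OF x(2)]] by linarith
      then show ?thesis using \<open>0 < a\<close> by (simp add: field_simps)
    qed
    have "(v' has_real_derivative v'' x) (at x)" if "x \<in> {0<..<t}" for x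
      using p[OF in_s(2)[of x]] t(2)[of x] that by simp
    then obtain b where "(v' \<longlongrightarrow> b) (at_right 0)"
      by (rule tendsto_at_right_if_bounded_deriv[OF t(1) _ v''_le])
    moreover have "\<not> (v \<longlongrightarrow> 0) (at_right 0)"
      using tendsto_unique[OF trivial_limit_at_right_real a(1)] False by blast
    ultimately show ?thesis using a(1) by blast
  qed
qed

end
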